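(* Every graph in $\varepsilon_{23}$ has a node of degree $2$.
   Context: All graphs are finite, simple and connected. An Euler graph is a connected graph all of whose nodes have even degree. A cycle of length $n$ is of type $i$ if $n\equiv i\pmod 4$. $\varepsilon_{23}$ is the class of Euler graphs in which every cycle has length $\equiv 2$ or $\equiv 3\pmod 4$ and which contain at least one cycle of each of the types $2$ and $3$. *)

theory Defs
  imports "Graph_Theory.Graph_Theory" "HOL-Number_Theory.Cong"
begin

text \<open>A finite simple graph is a \<^const>\<open>pair_graph\<close>: an edge \<open>uv\<close> is the pair of arcs
  \<open>(u, v)\<close>, \<open>(v, u)\<close>. Hence the degree of a node is its out-degree.\<close>

definition degree :: "'a pair_pre_digraph \<Rightarrow> 'a \<Rightarrow> nat" where
  "degree G v = out_degree (with_proj G) v"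

definition euler_graph :: "'a pair_pre_digraph \<Rightarrow> bool" where
  "euler_graph G \<longleftrightarrow>
     pair_graph G \<and> Digraph_Component.connected (with_proj G) \<and> (\<forall>v\<in>pverts G. even (degree G v))"

text \<open>\<^const>\<open>pre_digraph.cycle\<close> also accepts the back-and-forth walk \<open>(u, v), (v, u)\<close> along a single
  edge, which is not a cycle of the undirected graph; the length bound excludes exactly these
  walks.\<close>

definition graph_cycle :: "'a pair_pre_digraph \<Rightarrow> ('a \<times> 'a) awalk \<Rightarrow> bool" where
  "graph_cycle G p \<longleftrightarrow> pre_digraph.cycle (with_proj G) p \<and> 3 \<le> length p"

definition cycle_of_type :: "'a pair_pre_digraph \<Rightarrow> nat \<Rightarrow> ('a \<times> 'a) awalk \<Rightarrow> bool" where
  "cycle_of_type G i p \<longleftrightarrow> graph_cycle G p \<and> [length p = i] (mod 4)"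

definition epsilon23 :: "'a pair_pre_digraph set" where
  "epsilon23 = {G. euler_graph G \<and>
     (\<forall>p. graph_cycle G p \<longrightarrow> cycle_of_type G 2 p \<or> cycle_of_type G 3 p) \<and>
     (\<exists>p. cycle_of_type G 2 p) \<and> (\<exists>p. cycle_of_type G 3 p)}"

end

theory Submission
  imports Defs
begin

text \<open>Otherwise every non-isolated node has degree at least \<open>4\<close>. A graph of minimum degree at
  least \<open>3\<close> contains a subdivision of \<open>K\<^sub>4\<close>: among the longest paths \<open>p\<^sub>0, p\<^sub>1, \<dots>\<close> choose one whose
  first node has its last neighbour \<open>p\<^sub>k\<close> as early as possible, and let \<open>p\<^sub>i\<close> with \<open>1 < i < k\<close> be
  another neighbour of \<open>p\<^sub>0\<close>. Then \<open>p\<^sub>i\<^sub>-\<^sub>1, \<dots>, p\<^sub>0, p\<^sub>i, p\<^sub>i\<^sub>+\<^sub>1, \<dots>\<close> is a longest path too, so by the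
  choice of \<open>k\<close> the node \<open>p\<^sub>i\<^sub>-\<^sub>1\<close> has a neighbour \<open>p\<^sub>l\<close> with \<open>l \<ge> k\<close>, and \<open>p\<^sub>0, p\<^sub>i\<^sub>-\<^sub>1, p\<^sub>i, p\<^sub>k\<close> are the
  branch nodes of a subdivided \<open>K\<^sub>4\<close>. The lengths of the cycles of a subdivided \<open>K\<^sub>4\<close> cannot all be
  \<open>2\<close> or \<open>3\<close> modulo \<open>4\<close>.\<close>

text \<open>A neighbour of \<open>hd p\<close> outside \<open>p\<close> could be put in front of
  \<open>p\<close>, giving a longer path.\<close>

lemma longest_path_first_neighbours:
  assumes path: "distinct p" "successively (\<lambda>u v. (u, v) \<in> A) p" "set p \<subseteq> Domain A" "p \<noteq> []"
    and longest: "\<And>q. \<lbrakk>distinct q; successively (\<lambda>u v. (u, v) \<in> A) q; set q \<subseteq> Domain A\<rbrakk>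
      \<Longrightarrow> length q \<le> length p"
    and "sym A"
  shows "A `` {hd p} = (!) p ` {j. j < length p \<and> (hd p, p ! j) \<in> A}"
proof -
  have "w \<in> set p" if w: "(hd p, w) \<in> A" for w
  proof (rule ccontr)
    assume "w \<notin> set p"
    have "(w, hd p) \<in> A"
      using w \<open>sym A\<close> by (auto dest: symD)
    then have "length (w # p) \<le> length p"
      using \<open>w \<notin> set p\<close> path by (intro longest) (auto simp: successively_Cons)
    then show False by simp
  qed
  then show ?thesis
    by (auto simp: in_set_conv_nth image_iff)
qed

lemma min_degree_3_subdivided_K4:
  fixes A :: "('a \<times> 'a) set"
  assumes "finite A" "sym A" "irrefl A" "A \<noteq> {}"
    and deg: "\<And>v. v \<in> Domain A \<Longrightarrow> 3 \<le> card (A `` {v})"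
  obtains p i k l where "distinct p" "successively (\<lambda>u v. (u, v) \<in> A) p"
    "1 < i" "i < k" "k \<le> l" "l < length p"
    "(p ! 0, p ! i) \<in> A" "(p ! 0, p ! k) \<in> A" "(p ! (i - 1), p ! l) \<in> A"
proof -
  \<comment> \<open>A one-element list satisfies \<open>successively\<close> for any node; requiring
    nodes in \<open>Domain A\<close> bounds the length and makes \<open>deg\<close> applicable to
    the head.\<close>
  define is_path where "is_path = (\<lambda>p. distinct p \<and> successively (\<lambda>u v. (u, v) \<in> A) p
    \<and> set p \<subseteq> Domain A)"
  define N where "N = (\<lambda>p. {j. j < length p \<and> (hd p, p ! j) \<in> A})"
  obtain u where u: "u \<in> Domain A"
    using \<open>A \<noteq> {}\<close> by auto
  then have "is_path [u]"
    by (auto simp: is_path_def)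
  moreover have "\<forall>p. is_path p \<longrightarrow> length p < Suc (card (Domain A))"
    using \<open>finite A\<close>
    by (metis card_mono distinct_card finite_Domain is_path_def le_imp_less_Suc)
  ultimately obtain p0 where p0: "is_path p0" "\<forall>q. is_path q \<longrightarrow> length q \<le> length p0"
    using ex_has_greatest_nat[of is_path "[u]" length] by blast
  define longest where "longest = (\<lambda>p. is_path p \<and> length p = length p0)"
  obtain p where p: "longest p" and p_min: "\<And>q. longest q \<Longrightarrow> Max (N p) \<le> Max (N q)"
    using ex_has_least_nat[of longest p0 "\<lambda>q. Max (N q)"] p0 by (auto simp: longest_def)
  have "length p0 \<ge> 1"
    using p0(2) \<open>is_path [u]\<close> by fastforce
  have card_N: "3 \<le> card (N q)" and fin_N: "finite (N q)" if "longest q" for q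
  proof -
    have "q \<noteq> []"
      using that \<open>length p0 \<ge> 1\<close> by (auto simp: longest_def)
    then have "A `` {hd q} = (!) q ` N q"
      unfolding N_def using that p0(2) \<open>sym A\<close>
      by (intro longest_path_first_neighbours) (auto simp: longest_def is_path_def)
    moreover have "hd q \<in> Domain A"
      using \<open>q \<noteq> []\<close> that hd_in_set[of q] by (auto simp: longest_def is_path_def simp del: hd_in_set)
    moreover show "finite (N q)" by (simp add: N_def)
    ultimately show "3 \<le> card (N q)"
      using deg[of "hd q"] card_image_le[of "N q" "(!) q"] by simp
  qed
  define k where "k = Max (N p)"
  have "N p \<noteq> {}"
    using card_N[OF p] by auto
  then have k: "k \<in> N p"
    using fin_N[OF p] by (simp add: k_def)
  have "p \<noteq> []"
    using k by (auto simp: N_def)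
  \<comment> \<open>Position 1 is avoided so that \<open>p ! (i - 1)\<close> is not the first node
    itself.\<close>
  have "card {1, k} < card (N p)"
    using card_N[OF p] by (cases "k = 1") auto
  then obtain i where i: "i \<in> N p" "i \<noteq> 1" "i \<noteq> k"
    by (metis card_mono finite.emptyI finite.insertI insertCI linorder_not_less subsetI)
  have "i \<noteq> 0"
    using i(1) \<open>irrefl A\<close> \<open>p \<noteq> []\<close> by (auto simp: N_def irrefl_def hd_conv_nth intro: Nat.gr0I)
  then have "1 < i"
    using i by simp
  have "i < k"
    using i fin_N[OF p] by (simp add: k_def order_less_le)
  have "k < length p"
    using k by (simp add: N_def)
  define q where "q = rev (take i p) @ drop i p"
  have path_p: "distinct p" "successively (\<lambda>u v. (u, v) \<in> A) p" "set p \<subseteq> Domain A"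
    using p by (auto simp: longest_def is_path_def)
  have "successively (\<lambda>u v. (u, v) \<in> A) (take i p @ drop i p)"
    using path_p(2) by simp
  then have succ: "successively (\<lambda>u v. (u, v) \<in> A) (take i p)"
    "successively (\<lambda>u v. (u, v) \<in> A) (drop i p)"
    unfolding successively_append_iff by blast+
  have set_q: "set q = set p"
    unfolding q_def by (metis append_take_drop_id set_append set_rev)
  have "length q = length p"
    by (simp add: q_def)
  have hd_q: "hd q = p ! (i - 1)"
    using \<open>1 < i\<close> \<open>i < k\<close> \<open>k < length p\<close> \<open>p \<noteq> []\<close>
    by (simp add: q_def hd_append hd_rev last_conv_nth)
  have nth_q: "q ! j = p ! j" if "i \<le> j" "j < length p" for j
    using that by (simp add: q_def nth_append)
  have "successively (\<lambda>u v. (u, v) \<in> A) q"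
    unfolding q_def successively_append_iff successively_rev
    using succ \<open>sym A\<close> i(1) \<open>i \<noteq> 0\<close>
    by (auto simp: N_def last_rev hd_drop_conv_nth sym_def elim: successively_mono)
  moreover have "distinct q"
    using path_p(1) set_q \<open>length q = length p\<close> by (metis card_distinct distinct_card)
  ultimately have q: "longest q"
    using p set_q \<open>length q = length p\<close> by (auto simp: longest_def is_path_def)
  define l where "l = Max (N q)"
  have "k \<le> l"
    using p_min[OF q] by (simp add: k_def l_def)
  have "N q \<noteq> {}"
    using card_N[OF q] by auto
  then have "l \<in> N q"
    using fin_N[OF q] by (simp add: l_def)
  \<comment> \<open>\<open>l\<close> is a position in \<open>q\<close>, but the reversal only
    affects positions below \<open>i\<close>, and \<open>i < k \<le> l\<close>.\<close>
  then have l: "l < length p" "(p ! (i - 1), p ! l) \<in> A"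
    using hd_q nth_q[of l] \<open>k \<le> l\<close> \<open>i < k\<close> \<open>length q = length p\<close> by (auto simp: N_def)
  show thesis
    using that[OF path_p(1,2) \<open>1 < i\<close> \<open>i < k\<close> \<open>k \<le> l\<close> l(1)] i(1) k l(2) \<open>p \<noteq> []\<close>
    by (simp add: N_def hd_conv_nth)
qed

lemma successively_map_nth_upt:
  assumes "successively P p" "b \<le> length p"
  shows "successively P (map ((!) p) [a..<b])"
  using assms by (auto simp: successively_conv_nth)

text \<open>A closed walk is given here by the list of its nodes, the first of which is not repeated at
  the end.\<close>

lemma graph_cycle_of_vertex_list:
  assumes "pair_graph G" "distinct vs" "successively (\<lambda>u v. (u, v) \<in> parcs G) vs"
    and "(last vs, hd vs) \<in> parcs G" "3 \<le> length vs"
  obtains c where "graph_cycle G c" "length c = length vs"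
proof -
  interpret pair_graph G by fact
  have arcs: "set (vwalk_arcs (u # xs)) \<subseteq> parcs G \<and> length (vwalk_arcs (u # xs)) = length xs
      \<and> pawalk_verts u (vwalk_arcs (u # xs)) = u # xs \<and> pcas u (vwalk_arcs (u # xs)) (last (u # xs))"
    if "successively (\<lambda>u v. (u, v) \<in> parcs G) (u # xs)" for u xs
    using that by (induction xs arbitrary: u) auto
  have "vs \<noteq> []"
    using assms(5) by auto
  then obtain u ys where vs: "vs = u # ys"
    by (cases vs) auto
  let ?c = "vwalk_arcs (u # ys @ [u])"
  have "successively (\<lambda>u v. (u, v) \<in> parcs G) (u # ys @ [u])"
    using assms(3,4) unfolding vs append_Cons[symmetric] successively_append_iff by simp
  note c = arcs[OF this]
  have "u \<in> pverts G"
    using assms(4) vs by (auto dest: in_arcsD2)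
  then have "cycle ?c"
    unfolding cycle_def awalk_def using c assms(2) vs by (intro exI[of _ u]) auto
  then show thesis
    using that[of ?c] c assms(5) vs by (simp add: graph_cycle_def)
qed

theorem theorem25:
  fixes G :: "'a pair_pre_digraph"
  assumes "G \<in> epsilon23"
  shows "\<exists>v\<in>pverts G. degree G v = 2"
proof (rule ccontr)
  assume no2: "\<not> ?thesis"
  have G: "pair_graph G" and even: "\<And>v. v \<in> pverts G \<Longrightarrow> even (degree G v)"
    and types: "\<And>c. graph_cycle G c \<Longrightarrow> length c mod 4 = 2 \<or> length c mod 4 = 3"
    and ex: "\<exists>c. graph_cycle G c"
    using assms by (auto simp: epsilon23_def euler_graph_def cycle_of_type_def cong_def)
  interpret pair_graph G by (rule G)
  have degree: "degree G v = card (parcs G `` {v})" for v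
  proof -
    have "out_arcs (with_proj G) v = Pair v ` (parcs G `` {v})"
      by (auto simp: out_arcs_def)
    then show ?thesis
      by (simp add: degree_def out_degree_def card_image inj_on_def)
  qed
  \<comment> \<open>Nodes in the domain are not isolated, so an even degree other than 2 is at least
    4.\<close>
  have "3 \<le> card (parcs G `` {v})" if "v \<in> Domain (parcs G)" for v
  proof -
    have "v \<in> pverts G"
      using that by (auto dest: in_arcsD1)
    moreover have "card (parcs G `` {v}) \<noteq> 0"
      using that pair_finite_arcs by auto
    moreover have "even (card (parcs G `` {v}))" "card (parcs G `` {v}) \<noteq> 2"
      using even[of v] no2 \<open>v \<in> pverts G\<close> by (auto simp: degree)
    ultimately show ?thesis
      by presburger
  qed
  moreover have "sym (parcs G)"
    using pair_sym_arcs by (simp add: symmetric_def)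
  moreover have "irrefl (parcs G)"
    using pair_no_loops by (force simp: irrefl_def)
  moreover have "parcs G \<noteq> {}"
    using ex by (auto simp: graph_cycle_def cycle_def awalk_def)
  ultimately obtain p i k l where p: "distinct p" "successively (\<lambda>u v. (u, v) \<in> parcs G) p"
    and ord: "1 < i" "i < k" "k \<le> l" "l < length p"
    and chords: "(p ! 0, p ! i) \<in> parcs G" "(p ! 0, p ! k) \<in> parcs G" "(p ! (i - 1), p ! l) \<in> parcs G"
    using min_degree_3_subdivided_K4[OF pair_finite_arcs] by metis
  have chords': "(p ! i, p ! 0) \<in> parcs G" "(p ! k, p ! 0) \<in> parcs G" "(p ! l, p ! (i - 1)) \<in> parcs G"
    "(p ! i, p ! (i - 1)) \<in> parcs G"
    using chords \<open>sym (parcs G)\<close> successively_nth[OF p(2), of "i - 1"] ord by (auto dest: symD)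
  \<comment> \<open>Cycles are given by lists of positions in \<open>p\<close>, which reduces
    distinctness of nodes to distinctness of indices.\<close>
  have cyc: "length js mod 4 = 2 \<or> length js mod 4 = 3"
    if js: "distinct js" "\<forall>j\<in>set js. j < length p" "3 \<le> length js"
      "successively (\<lambda>u v. (u, v) \<in> parcs G) (map ((!) p) js)"
      "(p ! last js, p ! hd js) \<in> parcs G" for js
  proof -
    have "js \<noteq> []"
      using js(3) by auto
    have "distinct (map ((!) p) js)"
      using js(1,2) p(1) by (auto simp: distinct_map intro!: inj_on_nth)
    then obtain c where "graph_cycle G c" "length c = length (map ((!) p) js)"
      by (rule graph_cycle_of_vertex_list[OF G])
        (use js \<open>js \<noteq> []\<close> in \<open>simp_all add: hd_map last_map\<close>)
    then show ?thesis
      using types[of c] by simp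
  qed
  have fwd: "successively (\<lambda>u v. (u, v) \<in> parcs G) (map ((!) p) [a..<b])" if "b \<le> length p" for a b
    by (rule successively_map_nth_upt[OF p(2) that])
  have bwd: "successively (\<lambda>u v. (u, v) \<in> parcs G) (map ((!) p) (rev [a..<b]))" if "b \<le> length p" for a b
    unfolding rev_map[symmetric] successively_rev
    by (rule successively_mono[OF fwd[OF that, of a]]) (use \<open>sym (parcs G)\<close> in \<open>auto dest: symD\<close>)
  \<comment> \<open>Only \<open>z\<close> may be 0: if \<open>k = l\<close>, then
    \<open>p ! (i - 1)\<close> and \<open>p ! k\<close> are adjacent.\<close>
  obtain x y z where xyz: "i = Suc x" "k = Suc (x + y)" "l = Suc (x + y + z)" "0 < x" "0 < y"
  proof
    show "i = Suc (i - 1)" "k = Suc ((i - 1) + (k - i))" "l = Suc ((i - 1) + (k - i) + (l - k))"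
      using ord by auto
  qed (use ord in auto)
  have "p \<noteq> []"
    using ord by auto
  note simps = successively_append_iff successively_Cons last_map hd_map last_rev hd_rev
    hd_append last_append ball_Un
  note facts = ord(4)[unfolded xyz] chords[unfolded xyz] chords'[unfolded xyz] xyz(4,5) \<open>p \<noteq> []\<close>
  \<comment> \<open>The branch nodes are \<open>a = p\<^sub>0\<close>, \<open>b = p\<^sub>i\<^sub>-\<^sub>1\<close>, \<open>c = p\<^sub>i\<close>, \<open>d = p\<^sub>k\<close>; the paths \<open>ab\<close>, \<open>cd\<close>, \<open>bd\<close> have
    lengths \<open>x\<close>, \<open>y\<close>, \<open>z + 1\<close>, and \<open>bc\<close>, \<open>ac\<close>, \<open>ad\<close> are edges.\<close>
  have abc: "(x + 2) mod 4 = 2 \<or> (x + 2) mod 4 = 3"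
    using cyc[of "[0..<Suc (Suc x)]"] fwd[of "Suc (Suc x)" 0] facts
    by (simp add: simps del: upt_Suc)
  have acd: "(y + 2) mod 4 = 2 \<or> (y + 2) mod 4 = 3"
    using cyc[of "0 # [Suc x..<Suc (Suc (x + y))]"] fwd[of "Suc (Suc (x + y))" "Suc x"] facts
    by (simp add: simps del: upt_Suc)
  have abcd: "(x + y + 2) mod 4 = 2 \<or> (x + y + 2) mod 4 = 3"
    using cyc[of "[0..<Suc (Suc (x + y))]"] fwd[of "Suc (Suc (x + y))" 0] facts
    by (simp add: simps del: upt_Suc)
  \<comment> \<open>From \<open>b\<close> the chord leads to \<open>p ! l\<close>, and
    \<open>p\<close> is followed backwards to \<open>d\<close>.\<close>
  have acbd: "(z + 4) mod 4 = 2 \<or> (z + 4) mod 4 = 3"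
    using cyc[of "[0, Suc x, x] @ rev [Suc (x + y)..<Suc (Suc (x + y + z))]"]
      bwd[of "Suc (Suc (x + y + z))" "Suc (x + y)"] facts
    by (simp add: simps del: upt_Suc)
  have abd: "(x + z + 2) mod 4 = 2 \<or> (x + z + 2) mod 4 = 3"
    using cyc[of "[0..<Suc x] @ rev [Suc (x + y)..<Suc (Suc (x + y + z))]"]
      fwd[of "Suc x" 0] bwd[of "Suc (Suc (x + y + z))" "Suc (x + y)"] facts
    by (simp add: simps del: upt_Suc)
  have bcd: "(y + z + 2) mod 4 = 2 \<or> (y + z + 2) mod 4 = 3"
    using cyc[of "[x..<Suc (Suc (x + y + z))]"] fwd[of "Suc (Suc (x + y + z))" x] facts
    by (simp add: simps del: upt_Suc)
  \<comment> \<open>Modulo 4, \<open>abd\<close> and \<open>bcd\<close> then force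
    \<open>x = y = 1\<close> and \<open>z = 3\<close>, so the cycle \<open>abcd\<close> would have
    length divisible by 4.\<close>
  have "x mod 4 = 0 \<or> x mod 4 = 1" "y mod 4 = 0 \<or> y mod 4 = 1" "z mod 4 = 2 \<or> z mod 4 = 3"
    using abc acd acbd by presburger+
  moreover have "x mod 4 + z mod 4 \<noteq> 2 \<and> x mod 4 + z mod 4 \<noteq> 3"
    using abd by presburger
  moreover have "y mod 4 + z mod 4 \<noteq> 2 \<and> y mod 4 + z mod 4 \<noteq> 3"
    using bcd by presburger
  moreover have "x mod 4 + y mod 4 \<noteq> 2"
    using abcd by presburger
  ultimately show False
    by auto
qed

end
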